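(* Let $\alpha: I\to\mathbf{E}^4$ be a unit speed curve in Euclidean 4-space with curvatures $\kappa_1,\kappa_2,\kappa_3$, all nowhere zero on $I$. Then $\alpha$ is a slant helix if and only if there is an antiderivative $K=\int\kappa_1\,ds$ of $\kappa_1$ on $I$ such that the function $$s\longmapsto K(s)^2+\left[\frac{1}{\kappa_3(s)}\left(\frac{\kappa_1}{\kappa_2}K\right)'(s)+\frac{\kappa_2(s)}{\kappa_3(s)}\right]^2+\left(\frac{\kappa_1(s)}{\kappa_2(s)}K(s)\right)^2$$ is constant on $I$. Moreover, this constant equals $\tan^2\theta$, where $\theta$ is the angle that the principal normal $\mathbf{N}$ makes with the fixed direction $U$ that determines the slant helix $\alpha$.
   Context: $\mathbf{E}^4$ is $\mathbb{R}^4$ with the standard scalar product $\langle\cdot,\cdot\rangle$, and $I\subset\mathbb{R}$ is an open interval. A curve $\alpha:I\to\mathbf{E}^4$, assumed smooth, is of unit speed if $\langle\alpha'(s),\alpha'(s)\rangle=1$ for all $s\in I$. Its Frenet frame $\{\mathbf{T},\mathbf{N},\mathbf{B}_1,\mathbf{B}_2\}$ (tangent $\mathbf{T}=\alpha'$, principal normal, first binormal and second binormal) is an orthonormal frame along $\alpha$ satisfying $$\mathbf{T}'=\kappa_1\mathbf{N},\quad \mathbf{N}'=-\kappa_1\mathbf{T}+\kappa_2\mathbf{B}_1,\quad \mathbf{B}_1'=-\kappa_2\mathbf{N}+\kappa_3\mathbf{B}_2,\quad \mathbf{B}_2'=-\kappa_3\mathbf{B}_1,$$ where $\kappa_1,\kappa_2,\kappa_3: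 I\to\mathbb{R}$ are the first, second and third curvatures. Standing assumption: $\kappa_i(s)\neq 0$ for all $s\in I$ and $i=1,2,3$. The curve $\alpha$ is called a slant helix if its unit principal normal $\mathbf{N}$ makes a constant angle $\theta$ with a fixed direction $U$, i.e. there is a constant vector $U$, which may be taken of unit length, with $\langle\mathbf{N}(s),U\rangle=\cos\theta$ constant in $s\in I$. A prime denotes the derivative with respect to $s$.
   Formalization: The formal version requires the bracketed term not to vanish identically on I (else the converse fails, e.g. curvatures cos s, sin s, 1 on (0, π/2) with K = sin s) and excludes θ = π/2, where tan θ is undefined and the forward direction fails. *)

theory Defs
  imports "HOL-Analysis.Analysis"
begin

text \<open>All iterated derivatives exist; on an open set this is smoothness of class C-infinity.\<close>

definition smooth_curve_on :: "real set \<Rightarrow> (real \<Rightarrow> 'a::real_normed_vector) \<Rightarrow> bool" where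
  "smooth_curve_on I f \<longleftrightarrow>
     (\<forall>n::nat. ((\<lambda>g t. vector_derivative g (at t)) ^^ n) f differentiable_on I)"

text \<open>The frame and the curvatures are parameters rather than functions of the curve; since all
  three curvatures are nonzero, the equations determine them up to signs, and their smoothness
  follows from that of \<open>\<alpha>\<close>.\<close>

definition frenet_curve ::
  "real set \<Rightarrow> (real \<Rightarrow> real ^ 4) \<Rightarrow>
   (real \<Rightarrow> real ^ 4) \<Rightarrow> (real \<Rightarrow> real ^ 4) \<Rightarrow> (real \<Rightarrow> real ^ 4) \<Rightarrow> (real \<Rightarrow> real ^ 4) \<Rightarrow>
   (real \<Rightarrow> real) \<Rightarrow> (real \<Rightarrow> real) \<Rightarrow> (real \<Rightarrow> real) \<Rightarrow> bool" where
  "frenet_curve I \<alpha> T N B1 B2 \<kappa>1 \<kappa>2 \<kappa>3 \<longleftrightarrow>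
     smooth_curve_on I \<alpha> \<and>
     (\<forall>s\<in>I.
        (\<alpha> has_vector_derivative T s) (at s) \<and>
        norm (T s) = 1 \<and> norm (N s) = 1 \<and> norm (B1 s) = 1 \<and> norm (B2 s) = 1 \<and>
        T s \<bullet> N s = 0 \<and> T s \<bullet> B1 s = 0 \<and> T s \<bullet> B2 s = 0 \<and>
        N s \<bullet> B1 s = 0 \<and> N s \<bullet> B2 s = 0 \<and> B1 s \<bullet> B2 s = 0 \<and>
        (T has_vector_derivative (\<kappa>1 s *\<^sub>R N s)) (at s) \<and>
        (N has_vector_derivative (- \<kappa>1 s *\<^sub>R T s + \<kappa>2 s *\<^sub>R B1 s)) (at s) \<and>
        (B1 has_vector_derivative (- \<kappa>2 s *\<^sub>R N s + \<kappa>3 s *\<^sub>R B2 s)) (at s) \<and>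
        (B2 has_vector_derivative (- \<kappa>3 s *\<^sub>R B1 s)) (at s))"

text \<open>The right angle is excluded, since \<open>tan \<theta>\<close> has to be defined (in HOL, \<open>tan (pi/2) = 0\<close>).
  A unit field \<open>N\<close> orthogonal to \<open>U\<close> characterises a general helix (\<open>T \<bullet> U\<close> constant).\<close>

definition slant_axis :: "real set \<Rightarrow> (real \<Rightarrow> real ^ 4) \<Rightarrow> real ^ 4 \<Rightarrow> real \<Rightarrow> bool" where
  "slant_axis I N U \<theta> \<longleftrightarrow>
     norm U = 1 \<and> 0 \<le> \<theta> \<and> \<theta> \<le> pi \<and> \<theta> \<noteq> pi / 2 \<and> (\<forall>s\<in>I. N s \<bullet> U = cos \<theta>)"

definition slant_helix :: "real set \<Rightarrow> (real \<Rightarrow> real ^ 4) \<Rightarrow> bool" where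
  "slant_helix I N \<longleftrightarrow> (\<exists>U \<theta>. slant_axis I N U \<theta>)"

definition antiderivative_on :: "real set \<Rightarrow> (real \<Rightarrow> real) \<Rightarrow> (real \<Rightarrow> real) \<Rightarrow> bool" where
  "antiderivative_on I k K \<longleftrightarrow> (\<forall>s\<in>I. (K has_real_derivative k s) (at s))"

text \<open>The axis of a slant helix is
  \<open>U = cos \<theta> (K T + N + (\<kappa>1/\<kappa>2) K B1 + b B2)\<close>, where \<open>b\<close> is the following function.\<close>

definition second_binormal_term ::
  "(real \<Rightarrow> real) \<Rightarrow> (real \<Rightarrow> real) \<Rightarrow> (real \<Rightarrow> real) \<Rightarrow> (real \<Rightarrow> real) \<Rightarrow> real \<Rightarrow> real" where
  "second_binormal_term \<kappa>1 \<kappa>2 \<kappa>3 K s =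
     1 / \<kappa>3 s * deriv (\<lambda>t. \<kappa>1 t / \<kappa>2 t * K t) s + \<kappa>2 s / \<kappa>3 s"

definition slant_function ::
  "(real \<Rightarrow> real) \<Rightarrow> (real \<Rightarrow> real) \<Rightarrow> (real \<Rightarrow> real) \<Rightarrow> (real \<Rightarrow> real) \<Rightarrow> real \<Rightarrow> real" where
  "slant_function \<kappa>1 \<kappa>2 \<kappa>3 K s =
     (K s)\<^sup>2 + (second_binormal_term \<kappa>1 \<kappa>2 \<kappa>3 K s)\<^sup>2 + (\<kappa>1 s / \<kappa>2 s * K s)\<^sup>2"

text \<open>Constancy of \<open>slant_function\<close> alone does not make the curve a slant helix: for
  \<open>\<kappa>1 = cos\<close>, \<open>\<kappa>2 = sin\<close>, \<open>\<kappa>3 = 1\<close> on \<open>(0, pi/2)\<close> and \<open>K = sin\<close>, it is identically 1 and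
  \<open>second_binormal_term\<close> is identically 0, but the curve with these curvatures is not a slant
  helix. This degenerate case has to be excluded; for the \<open>K\<close> arising from the axis of a slant
  helix, \<open>second_binormal_term\<close> is never identically 0.\<close>

end

theory Submission
  imports Defs
begin

text \<open>Write a fixed vector \<open>U\<close> with \<open>N \<bullet> U = cos \<theta> \<noteq> 0\<close> in the Frenet frame and divide by
  \<open>cos \<theta>\<close>, so that the \<open>N\<close>-coordinate is \<open>1\<close>. By the Frenet equations, the other coordinates
  \<open>K\<close>, \<open>c\<close>, \<open>b\<close> along \<open>T\<close>, \<open>B1\<close>, \<open>B2\<close> belong to a constant vector if and only if
  \<open>K' = \<kappa>1\<close>, \<open>c = (\<kappa>1/\<kappa>2) K\<close>, \<open>\<kappa>3 b = c' + \<kappa>2\<close> and \<open>b' = - \<kappa>3 c\<close>. The first three equations say that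
  \<open>K\<close> is an antiderivative of \<open>\<kappa>1\<close> and determine \<open>c\<close> and \<open>b\<close> from it: \<open>b\<close> is
  \<open>second_binormal_term\<close>, and \<open>slant_function\<close> is \<open>K\<^sup>2 + b\<^sup>2 + c\<^sup>2\<close>.

  From an axis to \<open>K\<close> (\<open>slant_axis_imp_slant_function\<close>): the squared length of \<open>U / cos \<theta>\<close> is
  \<open>1 + K\<^sup>2 + b\<^sup>2 + c\<^sup>2 = 1 / (cos \<theta>)\<^sup>2\<close>, so the sum of squares is \<open>(tan \<theta>)\<^sup>2\<close>. If \<open>b\<close> vanished
  identically, then so would \<open>c\<close>, hence \<open>K\<close>, hence \<open>K' = \<kappa>1\<close>, against the
  assumption on \<open>\<kappa>1\<close>.

  From \<open>K\<close> to an axis (\<open>slant_function_constant_imp_slant_axis\<close>): differentiating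
  \<open>K\<^sup>2 + b\<^sup>2 + c\<^sup>2 = C\<close> and using \<open>\<kappa>1 K = \<kappa>2 c\<close> gives only \<open>b (b' + \<kappa>3 c) = 0\<close>, and the factor \<open>b\<close>
  has to be cancelled. As \<open>b\<close> is not identically zero, \<open>C > 0\<close>; so \<open>c \<noteq> 0\<close> wherever \<open>b = 0\<close>
  (\<open>b = c = 0\<close> would force \<open>K = 0\<close>). By \<open>cancel_factor_with_simple_zeros\<close>, on the connected set \<open>I\<close>
  the equation \<open>b' = - \<kappa>3 c\<close> then holds everywhere. This
  argument needs \<open>b\<close> to have a continuous derivative, hence the curvatures to be
  sufficiently differentiable; \<open>frenet_curvatures_smooth\<close> derives that from the smoothness of the
  curve.\<close>

section \<open>Iterated differentiability on an open set\<close>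

text \<open>The derivative is an existential witness, so that the closure properties follow by induction
  from the corresponding rules of differentiation.\<close>

primrec nth_differentiable :: "nat \<Rightarrow> real set \<Rightarrow> (real \<Rightarrow> 'a::real_normed_vector) \<Rightarrow> bool" where
  "nth_differentiable 0 I f \<longleftrightarrow> True"
| "nth_differentiable (Suc n) I f \<longleftrightarrow>
     (\<exists>f'. (\<forall>s\<in>I. (f has_vector_derivative f' s) (at s)) \<and> nth_differentiable n I f')"

lemma nth_differentiable_SucI:
  assumes "\<And>s. s \<in> I \<Longrightarrow> (f has_vector_derivative f' s) (at s)" "nth_differentiable n I f'"
  shows "nth_differentiable (Suc n) I f"
  using assms by auto

text \<open>The Frenet equations constrain the frame and the curvatures on \<open>I\<close> alone, so differentiability
  has to be transported along identities that hold only there.\<close>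

lemma nth_differentiable_cong:
  assumes "open I" "nth_differentiable n I f" "\<And>s. s \<in> I \<Longrightarrow> f s = g s"
  shows "nth_differentiable n I g"
proof (cases n)
  case (Suc m)
  then obtain f' where f': "\<And>s. s \<in> I \<Longrightarrow> (f has_vector_derivative f' s) (at s)"
      "nth_differentiable m I f'"
    using assms(2) by auto
  have "(g has_vector_derivative f' s) (at s)" if "s \<in> I" for s
    using has_vector_derivative_transform_within_open[OF f'(1)[OF that] assms(1) that] assms(3)
    by blast
  then show ?thesis
    unfolding Suc using f'(2) by (rule nth_differentiable_SucI)
qed simp

lemma nth_differentiable_derivative:
  assumes "open I" "nth_differentiable (Suc n) I f"
    and "\<And>s. s \<in> I \<Longrightarrow> (f has_vector_derivative f' s) (at s)"
  shows "nth_differentiable n I f'"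
proof -
  obtain g where g: "\<forall>s\<in>I. (f has_vector_derivative g s) (at s)" "nth_differentiable n I g"
    using assms(2) by auto
  show ?thesis
    using assms(1) g(2)
  proof (rule nth_differentiable_cong)
    show "g s = f' s" if "s \<in> I" for s
      using vector_derivative_unique_at g(1) assms(3) that by blast
  qed
qed

lemma nth_differentiable_Suc_imp:
  "nth_differentiable (Suc n) I f \<Longrightarrow> nth_differentiable n I f"
proof (induction n arbitrary: f)
  case (Suc n)
  then obtain f' where "\<And>s. s \<in> I \<Longrightarrow> (f has_vector_derivative f' s) (at s)"
      "nth_differentiable (Suc n) I f'"
    by auto
  with Suc.IH show ?case
    by (blast intro: nth_differentiable_SucI)
qed simp

lemma nth_differentiable_imp_continuous_on:
  assumes "nth_differentiable (Suc n) I f"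
  shows "continuous_on I f"
proof -
  obtain f' where "\<forall>s\<in>I. (f has_vector_derivative f' s) (at s)"
    using assms by auto
  then show ?thesis
    by (blast intro: continuous_at_imp_continuous_on has_vector_derivative_continuous)
qed

lemma nth_differentiable_const: "nth_differentiable n I (\<lambda>s. c)"
proof (induction n arbitrary: c)
  case (Suc n)
  then show ?case
    by (intro nth_differentiable_SucI[of _ _ "\<lambda>s. 0"]) (auto intro: has_vector_derivative_const)
qed simp

lemma nth_differentiable_add:
  "nth_differentiable n I f \<Longrightarrow> nth_differentiable n I g
    \<Longrightarrow> nth_differentiable n I (\<lambda>s. f s + g s)"
proof (induction n arbitrary: f g)
  case (Suc n)
  obtain f' where f': "\<forall>s\<in>I. (f has_vector_derivative f' s) (at s)" "nth_differentiable n I f'"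
    using Suc.prems(1) by auto
  obtain g' where g': "\<forall>s\<in>I. (g has_vector_derivative g' s) (at s)" "nth_differentiable n I g'"
    using Suc.prems(2) by auto
  show ?case
    by (rule nth_differentiable_SucI[OF _ Suc.IH[OF f'(2) g'(2)]])
      (use f'(1) g'(1) in \<open>blast intro: has_vector_derivative_add\<close>)
qed simp

lemma nth_differentiable_bilinear:
  assumes "bounded_bilinear h"
  shows "nth_differentiable n I f \<Longrightarrow> nth_differentiable n I g
    \<Longrightarrow> nth_differentiable n I (\<lambda>s. h (f s) (g s))"
proof (induction n arbitrary: f g)
  case (Suc n)
  obtain f' where f': "\<forall>s\<in>I. (f has_vector_derivative f' s) (at s)" "nth_differentiable n I f'"
    using Suc.prems(1) by auto
  obtain g' where g': "\<forall>s\<in>I. (g has_vector_derivative g' s) (at s)" "nth_differentiable n I g'"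
    using Suc.prems(2) by auto
  have "nth_differentiable n I f" "nth_differentiable n I g"
    using Suc.prems nth_differentiable_Suc_imp by blast+
  then have "nth_differentiable n I (\<lambda>s. h (f s) (g' s) + h (f' s) (g s))"
    using Suc.IH f'(2) g'(2) by (intro nth_differentiable_add) blast+
  moreover have "((\<lambda>s. h (f s) (g s)) has_vector_derivative h (f s) (g' s) + h (f' s) (g s))
      (at s)" if "s \<in> I" for s
    using bounded_bilinear.has_vector_derivative[OF assms] f'(1) g'(1) that by blast
  ultimately show ?case
    by (rule nth_differentiable_SucI[rotated])
qed simp

lemmas nth_differentiable_inner = nth_differentiable_bilinear[OF bounded_bilinear_inner]
lemmas nth_differentiable_scaleR = nth_differentiable_bilinear[OF bounded_bilinear_scaleR]
lemmas nth_differentiable_mult = nth_differentiable_bilinear[OF bounded_bilinear_mult]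

text \<open>The derivative of \<open>1/f\<close> is a product of \<open>f'\<close> with factors \<open>1/f\<close>, so one more order of
  differentiability of \<open>f\<close> gives one more for \<open>1/f\<close>.\<close>

lemma nth_differentiable_inverse:
  fixes f :: "real \<Rightarrow> real"
  assumes "\<And>s. s \<in> I \<Longrightarrow> f s \<noteq> 0"
  shows "nth_differentiable n I f \<Longrightarrow> nth_differentiable n I (\<lambda>s. inverse (f s))"
proof (induction n)
  case (Suc n)
  obtain f' where f': "\<forall>s\<in>I. (f has_vector_derivative f' s) (at s)" "nth_differentiable n I f'"
    using Suc.prems by auto
  have "nth_differentiable n I (\<lambda>s. inverse (f s))"
    using Suc nth_differentiable_Suc_imp by blast
  moreover have "nth_differentiable n I (\<lambda>s. - 1 :: real)"
    by (rule nth_differentiable_const)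
  ultimately have "nth_differentiable n I (\<lambda>s. - 1 * (inverse (f s) * f' s * inverse (f s)))"
    by (intro nth_differentiable_mult f')
  moreover have "((\<lambda>s. inverse (f s)) has_vector_derivative
      - 1 * (inverse (f s) * f' s * inverse (f s))) (at s)" if "s \<in> I" for s
    using DERIV_inverse'[of f "f' s" s UNIV] f'(1) assms that
    by (simp add: has_real_derivative_iff_has_vector_derivative)
  ultimately show ?case
    by (rule nth_differentiable_SucI[rotated])
qed simp

lemma nth_differentiable_divide:
  fixes f g :: "real \<Rightarrow> real"
  assumes "\<And>s. s \<in> I \<Longrightarrow> g s \<noteq> 0" "nth_differentiable n I f" "nth_differentiable n I g"
  shows "nth_differentiable n I (\<lambda>s. f s / g s)"
  unfolding divide_inverse
  by (intro nth_differentiable_mult nth_differentiable_inverse assms)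

lemma smooth_curve_on_imp_nth_differentiable:
  assumes "open I"
  shows "smooth_curve_on I f \<Longrightarrow> nth_differentiable n I f"
proof (induction n arbitrary: f)
  case (Suc n)
  let ?D = "\<lambda>g t. vector_derivative g (at t)"
  have "(?D ^^ m) (?D f) differentiable_on I" for m
    using Suc.prems unfolding smooth_curve_on_def by (metis funpow_swap1 funpow.simps(2) comp_apply)
  then have "nth_differentiable n I (?D f)"
    by (intro Suc.IH) (simp add: smooth_curve_on_def)
  moreover have "(f has_vector_derivative ?D f s) (at s)" if "s \<in> I" for s
  proof -
    have "(?D ^^ 0) f differentiable_on I"
      using Suc.prems unfolding smooth_curve_on_def by blast
    then have "f differentiable (at s)"
      using assms that by (simp add: differentiable_on_eq_differentiable_at)
    then show ?thesis
      by (simp add: vector_derivative_works)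
  qed
  ultimately show ?case
    by (rule nth_differentiable_SucI[rotated])
qed simp

section \<open>Smoothness of the curvatures\<close>

lemma unit_field_orthogonal_derivative:
  fixes E :: "real \<Rightarrow> 'a::real_inner"
  assumes "open I" "s \<in> I" "\<And>t. t \<in> I \<Longrightarrow> norm (E t) = 1"
    and "(E has_vector_derivative E') (at s)"
  shows "E s \<bullet> E' = 0"
proof -
  have "((\<lambda>t. E t \<bullet> E t) has_vector_derivative E s \<bullet> E' + E' \<bullet> E s) (at s)"
    using bounded_bilinear.has_vector_derivative[OF bounded_bilinear_inner assms(4) assms(4)] .
  moreover have "((\<lambda>t. E t \<bullet> E t) has_vector_derivative 0) (at s)"
    by (rule has_vector_derivative_transform_within_open[of "\<lambda>_. 1", OF _ assms(1,2)])
      (use assms(3) in \<open>auto simp: norm_eq_1\<close>)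
  ultimately show ?thesis
    using vector_derivative_unique_at by (fastforce simp: inner_commute)
qed

text \<open>A smooth nowhere vanishing field splits into a smooth length and a smooth direction, even if
  the direction is chosen with an arbitrary sign, as long as it is differentiable. The orders of
  differentiability of \<open>k\<close> and \<open>E\<close> are raised alternately: \<open>k' = X' \<bullet> E\<close> because
  \<open>X \<bullet> E' = k E \<bullet> E' = 0\<close>, and \<open>E = X / k\<close>.\<close>

lemma nth_differentiable_polar:
  fixes X E :: "real \<Rightarrow> 'a::real_inner"
  assumes I: "open I" and X: "\<And>n. nth_differentiable n I X"
    and eq: "\<And>s. s \<in> I \<Longrightarrow> X s = k s *\<^sub>R E s"
    and k: "\<And>s. s \<in> I \<Longrightarrow> k s \<noteq> 0"
    and E: "\<And>s. s \<in> I \<Longrightarrow> norm (E s) = 1"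
    and E': "\<And>s. s \<in> I \<Longrightarrow> (E has_vector_derivative E' s) (at s)"
  shows "nth_differentiable n I k \<and> nth_differentiable n I E"
proof (induction n)
  case (Suc n)
  obtain X' where X': "\<forall>s\<in>I. (X has_vector_derivative X' s) (at s)" "nth_differentiable n I X'"
    using X[of "Suc n"] by auto
  have "((\<lambda>s. X s \<bullet> E s) has_vector_derivative X' s \<bullet> E s) (at s)" if "s \<in> I" for s
    using bounded_bilinear.has_vector_derivative[OF bounded_bilinear_inner X'(1)[rule_format, OF that]
        E'[OF that]] unit_field_orthogonal_derivative[OF I that E E'[OF that]]
    by (simp add: eq that)
  moreover have "nth_differentiable n I (\<lambda>s. X' s \<bullet> E s)"
    using Suc X'(2) by (intro nth_differentiable_inner) auto
  ultimately have "nth_differentiable (Suc n) I (\<lambda>s. X s \<bullet> E s)"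
    by (rule nth_differentiable_SucI)
  then have k_Suc: "nth_differentiable (Suc n) I k"
    by (rule nth_differentiable_cong[OF I]) (use E in \<open>auto simp: eq norm_eq_1\<close>)
  then have "nth_differentiable (Suc n) I (\<lambda>s. inverse (k s) *\<^sub>R X s)"
    using k by (intro nth_differentiable_scaleR nth_differentiable_inverse X)
  then have "nth_differentiable (Suc n) I E"
    by (rule nth_differentiable_cong[OF I]) (simp add: eq k)
  with k_Suc show ?case by simp
qed simp

text \<open>Each Frenet equation expresses the product of a curvature with the next frame vector by
  quantities that are already known to be smooth.\<close>

lemma frenet_curvatures_smooth:
  assumes I: "open I" and F: "frenet_curve I \<alpha> T N B1 B2 \<kappa>1 \<kappa>2 \<kappa>3"
    and nz: "\<And>s. s \<in> I \<Longrightarrow> \<kappa>1 s \<noteq> 0 \<and> \<kappa>2 s \<noteq> 0 \<and> \<kappa>3 s \<noteq> 0"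
  shows "nth_differentiable n I \<kappa>1" "nth_differentiable n I \<kappa>2" "nth_differentiable n I \<kappa>3"
proof -
  note F = F[unfolded frenet_curve_def]
  have T: "nth_differentiable n I T" for n
    by (rule nth_differentiable_derivative[OF I smooth_curve_on_imp_nth_differentiable[OF I]])
      (use F in auto)
  have "nth_differentiable n I (\<lambda>s. \<kappa>1 s *\<^sub>R N s)" for n
    by (rule nth_differentiable_derivative[OF I T]) (use F in auto)
  then have 1: "nth_differentiable n I \<kappa>1 \<and> nth_differentiable n I N" for n
    by (rule nth_differentiable_polar[OF I]) (use F nz in auto)
  have "nth_differentiable n I (\<lambda>s. - \<kappa>1 s *\<^sub>R T s + \<kappa>2 s *\<^sub>R B1 s)" for n
    by (rule nth_differentiable_derivative[OF I conjunct2[OF 1]]) (use F in auto)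
  then have "nth_differentiable n I (\<lambda>s. (- \<kappa>1 s *\<^sub>R T s + \<kappa>2 s *\<^sub>R B1 s) + \<kappa>1 s *\<^sub>R T s)" for n
    by (rule nth_differentiable_add[OF _ nth_differentiable_scaleR[OF conjunct1[OF 1] T]])
  then have 2: "nth_differentiable n I \<kappa>2 \<and> nth_differentiable n I B1" for n
    by (rule nth_differentiable_polar[OF I]) (use F nz in auto)
  have "nth_differentiable n I (\<lambda>s. - \<kappa>2 s *\<^sub>R N s + \<kappa>3 s *\<^sub>R B2 s)" for n
    by (rule nth_differentiable_derivative[OF I conjunct2[OF 2]]) (use F in auto)
  then have "nth_differentiable n I (\<lambda>s. (- \<kappa>2 s *\<^sub>R N s + \<kappa>3 s *\<^sub>R B2 s) + \<kappa>2 s *\<^sub>R N s)" for n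
    by (rule nth_differentiable_add
        [OF _ nth_differentiable_scaleR[OF conjunct1[OF 2] conjunct2[OF 1]]])
  then have 3: "nth_differentiable n I \<kappa>3 \<and> nth_differentiable n I B2" for n
    by (rule nth_differentiable_polar[OF I]) (use F nz in auto)
  show "nth_differentiable n I \<kappa>1" "nth_differentiable n I \<kappa>2" "nth_differentiable n I \<kappa>3"
    using 1 2 3 by auto
qed

section \<open>Recovering the last linear equation from the first integral\<close>

text \<open>At a zero of \<open>b\<close> where \<open>b' = - g\<close>, the derivative is nonzero, so \<open>b\<close> does not vanish at
  other points nearby and \<open>b' = - g\<close> holds there too. Hence the set where \<open>b' = - g\<close> is open; it is
  also relatively closed, and nonempty as soon as \<open>b\<close> is not identically zero.\<close>

lemma cancel_factor_with_simple_zeros: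
  fixes b b' g :: "real \<Rightarrow> real"
  assumes I: "open I" "connected I"
    and b: "\<And>s. s \<in> I \<Longrightarrow> (b has_real_derivative b' s) (at s)"
    and cont: "continuous_on I b'" "continuous_on I g"
    and prod: "\<And>s. s \<in> I \<Longrightarrow> b s * (b' s + g s) = 0"
    and simple: "\<And>s. s \<in> I \<Longrightarrow> b s = 0 \<Longrightarrow> g s \<noteq> 0"
    and nz: "s0 \<in> I" "b s0 \<noteq> 0"
    and s: "s \<in> I"
  shows "b' s = - g s"
proof -
  define A where "A = {t \<in> I. b' t + g t = 0}"
  have "\<exists>S. open S \<and> t \<in> S \<and> S \<subseteq> A" if "t \<in> A" for t
  proof -
    from that have t: "t \<in> I" "b' t = - g t" by (auto simp: A_def)
    have "eventually (\<lambda>u. b u \<noteq> 0) (at t)"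
    proof (cases "b t = 0")
      case True
      have "((\<lambda>u. (b u - b t) / (u - t)) \<longlongrightarrow> b' t) (at t)"
        using b[OF t(1)] by (simp add: has_field_derivative_iff)
      moreover have "b' t \<noteq> 0"
        using simple[OF t(1) True] t(2) by simp
      ultimately have "eventually (\<lambda>u. (b u - b t) / (u - t) \<noteq> 0) (at t)"
        by (rule tendsto_imp_eventually_ne)
      then show ?thesis
        by eventually_elim (use True in auto)
    next
      case False
      have "(b \<longlongrightarrow> b t) (at t)"
        using DERIV_isCont[OF b[OF t(1)]] by (simp add: isCont_def)
      then show ?thesis
        using False by (rule tendsto_imp_eventually_ne)
    qed
    then have "eventually (\<lambda>u. u \<noteq> t \<longrightarrow> b u \<noteq> 0) (nhds t)"
      by (simp add: eventually_at_filter)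
    moreover have "eventually (\<lambda>u. u \<in> I) (nhds t)"
      using I(1) t(1) by (rule eventually_nhds_in_open)
    ultimately have "eventually (\<lambda>u. u \<in> A) (nhds t)"
    proof eventually_elim
      case (elim u)
      then show ?case
        using prod[of u] that by (cases "u = t") (auto simp: A_def)
    qed
    then show ?thesis
      unfolding eventually_nhds by blast
  qed
  then have "open A"
    by (subst open_subopen) blast
  then have "openin (top_of_set I) A"
    by (rule open_subset[rotated]) (auto simp: A_def)
  moreover have "closedin (top_of_set I) A"
    unfolding A_def by (intro continuous_closedin_preimage_constant continuous_on_add cont)
  moreover have "s0 \<in> A"
    using prod[OF nz(1)] nz by (auto simp: A_def)
  ultimately have "A = I"
    using I(2) unfolding connected_clopen by blast
  with s have "s \<in> A" by simp
  then show ?thesis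
    by (simp add: A_def)
qed

section \<open>Coordinates in an orthonormal frame\<close>

text \<open>Nonzero pairwise orthogonal vectors are independent, so by cardinality \<open>B\<close> spans the whole
  space; the residue of \<open>x\<close> after projection to \<open>B\<close> is orthogonal to \<open>B\<close> and hence to itself.\<close>

lemma norm_square_orthonormal_basis:
  fixes B :: "'a::euclidean_space set"
  assumes orth: "pairwise orthogonal B" and unit: "\<And>b. b \<in> B \<Longrightarrow> norm b = 1"
    and card: "card B = DIM('a)"
  shows "(norm x)\<^sup>2 = (\<Sum>b\<in>B. (b \<bullet> x)\<^sup>2)"
proof -
  have fin: "finite B"
    using card by (metis card.infinite DIM_positive less_irrefl)
  have "independent B"
    using pairwise_orthogonal_independent[OF orth] unit by fastforce
  then have span: "span B = UNIV"
    using card card_ge_dim_independent[of B UNIV] by (auto simp: dim_UNIV)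
  have ip: "a \<bullet> b = (if a = b then 1 else 0)" if "a \<in> B" "b \<in> B" for a b
    using orth unit that by (auto simp: pairwise_def orthogonal_def norm_eq_1)
  define y where "y = x - (\<Sum>b\<in>B. (b \<bullet> x) *\<^sub>R b)"
  have "a \<bullet> y = 0" if "a \<in> B" for a
  proof -
    have "(\<Sum>b\<in>B. (b \<bullet> x) * (a \<bullet> b)) = (\<Sum>b\<in>B. if a = b then b \<bullet> x else 0)"
      using ip that by (intro sum.cong) auto
    also have "\<dots> = a \<bullet> x"
      using fin that by simp
    finally show ?thesis
      by (simp add: y_def inner_diff_right inner_sum_right)
  qed
  then have "orthogonal y y"
    using orthogonal_to_span[of y B y] span by (auto simp: orthogonal_def inner_commute)
  then have "y = 0"
    by (simp add: orthogonal_def)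
  then have "x = (\<Sum>b\<in>B. (b \<bullet> x) *\<^sub>R b)"
    by (simp add: y_def)
  then have "x \<bullet> x = (\<Sum>b\<in>B. (b \<bullet> x) *\<^sub>R b) \<bullet> x"
    by simp
  then show ?thesis
    by (simp add: power2_norm_eq_inner inner_sum_left flip: power2_eq_square)
qed

lemma frame_norm_square:
  fixes t n b1 b2 u :: "real ^ 4"
  assumes "norm t = 1" "norm n = 1" "norm b1 = 1" "norm b2 = 1"
    and "t \<bullet> n = 0" "t \<bullet> b1 = 0" "t \<bullet> b2 = 0" "n \<bullet> b1 = 0" "n \<bullet> b2 = 0" "b1 \<bullet> b2 = 0"
  shows "(norm u)\<^sup>2 = (t \<bullet> u)\<^sup>2 + (n \<bullet> u)\<^sup>2 + (b1 \<bullet> u)\<^sup>2 + (b2 \<bullet> u)\<^sup>2"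
proof -
  have ne: "t \<noteq> n" "t \<noteq> b1" "t \<noteq> b2" "n \<noteq> b1" "n \<noteq> b2" "b1 \<noteq> b2"
    using assms by (auto simp: norm_eq_1)
  have "(norm u)\<^sup>2 = (\<Sum>b\<in>{t, n, b1, b2}. (b \<bullet> u)\<^sup>2)"
    by (rule norm_square_orthonormal_basis)
      (use assms ne in \<open>auto simp: pairwise_def orthogonal_def inner_commute\<close>)
  then show ?thesis
    using ne by simp
qed

section \<open>Slant helices\<close>

text \<open>Paired with the axis, the equations for \<open>T'\<close>, \<open>N'\<close> and \<open>B1'\<close> identify the coordinates along
  \<open>T\<close>, \<open>B1\<close> and \<open>B2\<close> in turn; the equation for \<open>B2'\<close> shows that the last one is not identically
  zero.\<close>

lemma slant_axis_imp_slant_function: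
  assumes I: "open I" "I \<noteq> {}"
    and F: "frenet_curve I \<alpha> T N B1 B2 \<kappa>1 \<kappa>2 \<kappa>3"
    and nz: "\<And>s. s \<in> I \<Longrightarrow> \<kappa>1 s \<noteq> 0 \<and> \<kappa>2 s \<noteq> 0 \<and> \<kappa>3 s \<noteq> 0"
    and ax: "slant_axis I N U \<theta>"
  shows "\<exists>K. antiderivative_on I \<kappa>1 K \<and>
           (\<exists>s\<in>I. second_binormal_term \<kappa>1 \<kappa>2 \<kappa>3 K s \<noteq> 0) \<and>
           (\<forall>s\<in>I. slant_function \<kappa>1 \<kappa>2 \<kappa>3 K s = (tan \<theta>)\<^sup>2)"
proof -
  note F = F[unfolded frenet_curve_def]
  have U: "norm U = 1" and N: "\<And>s. s \<in> I \<Longrightarrow> N s \<bullet> U = cos \<theta>"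
    using ax by (auto simp: slant_axis_def)
  have "\<theta> = pi / 2" if "cos \<theta> = 0"
    using that ax cos_inj_pi[of \<theta> "pi / 2"] by (auto simp: slant_axis_def)
  then have cos: "cos \<theta> \<noteq> 0"
    using ax by (auto simp: slant_axis_def)
  define K where "K = (\<lambda>s. (T s \<bullet> U) / cos \<theta>)"
  let ?c = "\<lambda>t. \<kappa>1 t / \<kappa>2 t * K t"
  let ?b = "second_binormal_term \<kappa>1 \<kappa>2 \<kappa>3 K"
  have comp: "((\<lambda>t. (X t \<bullet> U) / cos \<theta>) has_real_derivative (X' \<bullet> U) / cos \<theta>) (at s)"
    if "(X has_vector_derivative X') (at s)" for X X' s
  proof -
    have "((\<lambda>t. X t \<bullet> U) has_real_derivative X' \<bullet> U) (at s)"
      using bounded_linear.has_vector_derivative[OF bounded_linear_inner_left that]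
      by (simp add: has_real_derivative_iff_has_vector_derivative)
    then show ?thesis by (rule DERIV_cdivide)
  qed
  have K: "antiderivative_on I \<kappa>1 K"
    unfolding antiderivative_on_def
  proof
    fix s assume s: "s \<in> I"
    then show "(K has_real_derivative \<kappa>1 s) (at s)"
      using comp[of T "\<kappa>1 s *\<^sub>R N s" s] F N[OF s] cos by (simp add: K_def)
  qed
  (* This is N' \<bullet> U = 0, because N \<bullet> U is constant. *)
  have c: "?c s = (B1 s \<bullet> U) / cos \<theta>" if s: "s \<in> I" for s
  proof -
    have "((\<lambda>t. (N t \<bullet> U) / cos \<theta>) has_real_derivative
        ((- \<kappa>1 s *\<^sub>R T s + \<kappa>2 s *\<^sub>R B1 s) \<bullet> U) / cos \<theta>) (at s)"
      using F s by (intro comp) auto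
    moreover have "((\<lambda>t. (N t \<bullet> U) / cos \<theta>) has_real_derivative 0) (at s)"
      by (rule has_field_derivative_transform_within_open[of "\<lambda>_. 1", OF _ I(1) s]) (auto simp: N cos)
    ultimately have "((- \<kappa>1 s *\<^sub>R T s + \<kappa>2 s *\<^sub>R B1 s) \<bullet> U) / cos \<theta> = 0"
      by (rule DERIV_unique)
    then show ?thesis
      using cos nz[OF s] by (simp add: K_def inner_add_left inner_diff_left field_simps)
  qed
  have b: "?b s = (B2 s \<bullet> U) / cos \<theta>" if s: "s \<in> I" for s
  proof -
    have "((\<lambda>t. (B1 t \<bullet> U) / cos \<theta>) has_real_derivative
        ((- \<kappa>2 s *\<^sub>R N s + \<kappa>3 s *\<^sub>R B2 s) \<bullet> U) / cos \<theta>) (at s)"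
      using F s by (intro comp) auto
    then have "(?c has_real_derivative
        ((- \<kappa>2 s *\<^sub>R N s + \<kappa>3 s *\<^sub>R B2 s) \<bullet> U) / cos \<theta>) (at s)"
      by (rule has_field_derivative_transform_within_open[OF _ I(1) s]) (rule c[symmetric])
    then have "deriv ?c s = ((- \<kappa>2 s *\<^sub>R N s + \<kappa>3 s *\<^sub>R B2 s) \<bullet> U) / cos \<theta>"
      by (rule DERIV_imp_deriv)
    then show ?thesis
      using cos nz[OF s] N[OF s]
      by (simp add: second_binormal_term_def inner_add_left inner_diff_left field_simps)
  qed
  have "\<exists>s\<in>I. ?b s \<noteq> 0"
  proof (rule ccontr)
    assume "\<not> (\<exists>s\<in>I. ?b s \<noteq> 0)"
    then have b0: "\<And>s. s \<in> I \<Longrightarrow> (B2 s \<bullet> U) / cos \<theta> = 0"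
      by (metis b)
    (* From B2 \<bullet> U = 0 on I, its derivative - \<kappa>3 (B1 \<bullet> U) vanishes, that is c = 0. *)
    have K0: "K s = 0" if s: "s \<in> I" for s
    proof -
      have "((\<lambda>t. (B2 t \<bullet> U) / cos \<theta>) has_real_derivative ((- \<kappa>3 s *\<^sub>R B1 s) \<bullet> U) / cos \<theta>) (at s)"
        using F s by (intro comp) auto
      moreover have "((\<lambda>t. (B2 t \<bullet> U) / cos \<theta>) has_real_derivative 0) (at s)"
        by (rule has_field_derivative_transform_within_open[of "\<lambda>_. 0", OF _ I(1) s])
          (simp_all add: b0 del: divide_eq_0_iff)
      ultimately have "((- \<kappa>3 s *\<^sub>R B1 s) \<bullet> U) / cos \<theta> = 0"
        by (rule DERIV_unique)
      then show ?thesis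
        using c[OF s] nz[OF s] cos by auto
    qed
    obtain s where s: "s \<in> I" using I(2) by blast
    have "(K has_real_derivative 0) (at s)"
      by (rule has_field_derivative_transform_within_open[of "\<lambda>_. 0", OF _ I(1) s])
          (simp_all add: K0)
    then have "\<kappa>1 s = 0"
      using K s DERIV_unique unfolding antiderivative_on_def by blast
    then show False using nz[OF s] by simp
  qed
  moreover have "slant_function \<kappa>1 \<kappa>2 \<kappa>3 K s = (tan \<theta>)\<^sup>2" if s: "s \<in> I" for s
  proof -
    have "1 = (T s \<bullet> U)\<^sup>2 + (cos \<theta>)\<^sup>2 + (B1 s \<bullet> U)\<^sup>2 + (B2 s \<bullet> U)\<^sup>2"
      using frame_norm_square[of "T s" "N s" "B1 s" "B2 s" U] F s U N[OF s] by simp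
    then have "(T s \<bullet> U)\<^sup>2 + (B2 s \<bullet> U)\<^sup>2 + (B1 s \<bullet> U)\<^sup>2 = (sin \<theta>)\<^sup>2"
      by (simp add: sin_squared_eq)
    then show ?thesis
      unfolding slant_function_def b[OF s] c[OF s]
      by (simp add: K_def tan_def power_divide flip: add_divide_distrib)
  qed
  ultimately show ?thesis
    using K by blast
qed

text \<open>The axis is the direction of \<open>K T + N + c B1 + b B2\<close>. Its \<open>N\<close>-coordinate \<open>1\<close> and its length
  \<open>sqrt (1 + C)\<close> determine the angle.\<close>

lemma slant_function_constant_imp_slant_axis:
  assumes I: "open I" "is_interval I"
    and F: "frenet_curve I \<alpha> T N B1 B2 \<kappa>1 \<kappa>2 \<kappa>3"
    and nz: "\<And>s. s \<in> I \<Longrightarrow> \<kappa>1 s \<noteq> 0 \<and> \<kappa>2 s \<noteq> 0 \<and> \<kappa>3 s \<noteq> 0"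
    and K: "antiderivative_on I \<kappa>1 K"
    and ex: "\<exists>s\<in>I. second_binormal_term \<kappa>1 \<kappa>2 \<kappa>3 K s \<noteq> 0"
    and const: "\<And>s. s \<in> I \<Longrightarrow> slant_function \<kappa>1 \<kappa>2 \<kappa>3 K s = C"
  shows "\<exists>U \<theta>. slant_axis I N U \<theta> \<and> C = (tan \<theta>)\<^sup>2"
proof -
  note sm = frenet_curvatures_smooth[OF I(1) F nz]
  note F = F[unfolded frenet_curve_def]
  define c where "c = (\<lambda>t. \<kappa>1 t / \<kappa>2 t * K t)"
  define b where "b = second_binormal_term \<kappa>1 \<kappa>2 \<kappa>3 K"
  have DK: "(K has_real_derivative \<kappa>1 s) (at s)" if "s \<in> I" for s
    using K that by (auto simp: antiderivative_on_def)
  have smK: "nth_differentiable n I K" for n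
    by (rule nth_differentiable_Suc_imp[OF nth_differentiable_SucI[OF _ sm(1)]])
      (use DK in \<open>simp add: has_real_derivative_iff_has_vector_derivative\<close>)
  have smc: "nth_differentiable n I c" for n
    unfolding c_def using nz
    by (intro nth_differentiable_mult nth_differentiable_divide sm smK) auto
  have deriv: "(f has_real_derivative deriv f s) (at s)"
    if "nth_differentiable (Suc 0) I f" "s \<in> I" for f s
  proof -
    obtain f' where "\<forall>s\<in>I. (f has_real_derivative f' s) (at s)"
      using \<open>nth_differentiable (Suc 0) I f\<close>
      by (auto simp: has_real_derivative_iff_has_vector_derivative)
    then show ?thesis
      using \<open>s \<in> I\<close> DERIV_imp_deriv by metis
  qed
  have smderiv: "nth_differentiable n I (deriv f)"
    if "\<And>n. nth_differentiable n I f" for n and f :: "real \<Rightarrow> real"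
    by (rule nth_differentiable_derivative[OF I(1) that])
      (use deriv[OF that] in \<open>simp add: has_real_derivative_iff_has_vector_derivative\<close>)
  have b_eq: "b s = (deriv c s + \<kappa>2 s) / \<kappa>3 s" for s
    by (simp add: b_def c_def second_binormal_term_def add_divide_distrib)
  have smb: "nth_differentiable n I b" for n
    unfolding b_eq[abs_def] using nz
    by (intro nth_differentiable_divide nth_differentiable_add sm smderiv[OF smc]) auto
  have Dc: "(c has_real_derivative \<kappa>3 s * b s - \<kappa>2 s) (at s)" if "s \<in> I" for s
    using deriv[OF smc that] nz[OF that] by (simp add: b_eq)
  have Db: "(b has_real_derivative deriv b s) (at s)" if "s \<in> I" for s
    by (rule deriv[OF smb that])
  have C: "(K s)\<^sup>2 + (b s)\<^sup>2 + (c s)\<^sup>2 = C" if "s \<in> I" for s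
    using const[OF that] by (simp add: slant_function_def b_def c_def)
  have Kc: "\<kappa>1 s * K s = \<kappa>2 s * c s" if "s \<in> I" for s
    using nz[OF that] by (simp add: c_def)
  obtain s0 where s0: "s0 \<in> I" "b s0 \<noteq> 0"
    using ex by (auto simp: b_def)
  have "C > 0"
    using C[OF s0(1)] s0(2) by (metis add_pos_nonneg add_nonneg_pos zero_le_power2 zero_less_power2)
  have eq: "deriv b s = - (\<kappa>3 s * c s)" if "s \<in> I" for s
  proof (rule cancel_factor_with_simple_zeros[where b = b and b' = "deriv b"
        and g = "\<lambda>s. \<kappa>3 s * c s" and I = I])
    show "connected I" using I(2) by (rule is_interval_connected)
    show "continuous_on I (deriv b)" "continuous_on I (\<lambda>s. \<kappa>3 s * c s)"
      using nth_differentiable_imp_continuous_on[of 0] smderiv[OF smb]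
        nth_differentiable_mult[OF sm(3) smc] by blast+
  next
    fix s assume s: "s \<in> I"
    have "((\<lambda>t. (K t)\<^sup>2 + (b t)\<^sup>2 + (c t)\<^sup>2) has_real_derivative
        2 * (\<kappa>1 s * K s + b s * deriv b s + c s * (\<kappa>3 s * b s - \<kappa>2 s))) (at s)"
      using DK[OF s] Db[OF s] Dc[OF s]
      by (auto intro!: derivative_eq_intros simp: algebra_simps)
    moreover have "((\<lambda>t. (K t)\<^sup>2 + (b t)\<^sup>2 + (c t)\<^sup>2) has_real_derivative 0) (at s)"
      by (rule has_field_derivative_transform_within_open[of "\<lambda>_. C", OF _ I(1) s]) (simp_all add: C)
    ultimately have "2 * (\<kappa>1 s * K s + b s * deriv b s + c s * (\<kappa>3 s * b s - \<kappa>2 s)) = 0"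
      by (rule DERIV_unique)
    then show "b s * (deriv b s + \<kappa>3 s * c s) = 0"
      using Kc[OF s] by (simp add: algebra_simps)
  next
    fix s assume s: "s \<in> I" "b s = 0"
    show "\<kappa>3 s * c s \<noteq> 0"
    proof
      assume "\<kappa>3 s * c s = 0"
      then have "c s = 0" "K s = 0"
        using nz[OF s(1)] Kc[OF s(1)] by auto
      then show False
        using C[OF s(1)] s(2) \<open>C > 0\<close> by simp
    qed
  qed (use I(1) Db s0 that in auto)
  define V where "V = (\<lambda>s. K s *\<^sub>R T s + N s + c s *\<^sub>R B1 s + b s *\<^sub>R B2 s)"
  have "(V has_vector_derivative 0) (at s)" if s: "s \<in> I" for s
  proof -
    have "(V has_vector_derivative
        ((K s *\<^sub>R (\<kappa>1 s *\<^sub>R N s) + \<kappa>1 s *\<^sub>R T s)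
         + (- \<kappa>1 s *\<^sub>R T s + \<kappa>2 s *\<^sub>R B1 s)
         + (c s *\<^sub>R (- \<kappa>2 s *\<^sub>R N s + \<kappa>3 s *\<^sub>R B2 s) + (\<kappa>3 s * b s - \<kappa>2 s) *\<^sub>R B1 s)
         + (b s *\<^sub>R (- \<kappa>3 s *\<^sub>R B1 s) + (- (\<kappa>3 s * c s)) *\<^sub>R B2 s))) (at s)"
      unfolding V_def using F s DK[OF s] Dc[OF s] Db[OF s] eq[OF s]
      by (intro has_vector_derivative_add has_vector_derivative_scaleR) auto
    moreover have "((K s *\<^sub>R (\<kappa>1 s *\<^sub>R N s) + \<kappa>1 s *\<^sub>R T s)
         + (- \<kappa>1 s *\<^sub>R T s + \<kappa>2 s *\<^sub>R B1 s)
         + (c s *\<^sub>R (- \<kappa>2 s *\<^sub>R N s + \<kappa>3 s *\<^sub>R B2 s) + (\<kappa>3 s * b s - \<kappa>2 s) *\<^sub>R B1 s)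
         + (b s *\<^sub>R (- \<kappa>3 s *\<^sub>R B1 s) + (- (\<kappa>3 s * c s)) *\<^sub>R B2 s))
        = (\<kappa>1 s * K s - \<kappa>2 s * c s) *\<^sub>R N s"
      by (simp add: algebra_simps)
    ultimately show ?thesis
      using Kc[OF s] by simp
  qed
  (* The N-coordinate of V' is \<kappa>1 K - \<kappa>2 c = 0; the other three cancel identically. *)
  then have "\<exists>W. \<forall>s\<in>I. V s = W"
    using has_vector_derivative_zero_constant[of I V] I(2)
    by (metis has_vector_derivative_at_within is_interval_convex)
  then obtain W where W: "\<And>s. s \<in> I \<Longrightarrow> V s = W" by blast
  have NW: "N s \<bullet> W = 1" if s: "s \<in> I" for s
    unfolding W[OF s, symmetric] V_def using F s
    by (simp add: inner_add_right inner_commute norm_eq_1)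
  have "(norm W)\<^sup>2 = 1 + C"
    using frame_norm_square[of "T s0" "N s0" "B1 s0" "B2 s0" W] F s0(1) C[OF s0(1)]
    unfolding W[OF s0(1), symmetric] V_def
    by (simp add: inner_add_right inner_commute norm_eq_1)
  then have normW: "norm W = sqrt (1 + C)"
    by (simp add: real_sqrt_unique)
  define \<theta> where "\<theta> = arccos (1 / norm W)"
  have pos: "0 < 1 / norm W" "1 / norm W \<le> 1"
    using \<open>C > 0\<close> by (simp_all add: normW)
  then have cos: "cos \<theta> = 1 / norm W"
    unfolding \<theta>_def by (intro cos_arccos) linarith+
  have "slant_axis I N (W /\<^sub>R norm W) \<theta>"
    unfolding slant_axis_def
  proof (intro conjI ballI)
    show "norm (W /\<^sub>R norm W) = 1" using pos by auto
    show "0 \<le> \<theta>" "\<theta> \<le> pi"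
      unfolding \<theta>_def using pos by (intro arccos_lbound arccos_ubound; linarith)+
    show "\<theta> \<noteq> pi / 2" using cos pos(1) by (metis cos_pi_half less_irrefl)
    show "N s \<bullet> (W /\<^sub>R norm W) = cos \<theta>" if "s \<in> I" for s
      using NW[OF that] cos by (simp add: divide_inverse)
  qed
  moreover have "(tan \<theta>)\<^sup>2 = C"
  proof -
    have "1 + (tan \<theta>)\<^sup>2 = inverse (cos \<theta>) ^ 2"
      using cos pos tan_sec[of \<theta>] by auto
    also have "\<dots> = 1 + C"
      using \<open>(norm W)\<^sup>2 = 1 + C\<close> by (simp add: cos)
    finally show ?thesis by simp
  qed
  ultimately show ?thesis by blast
qed

theorem theorem1p3:
  fixes I :: "real set"
    and \<alpha> T N B1 B2 :: "real \<Rightarrow> real ^ 4"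
    and \<kappa>1 \<kappa>2 \<kappa>3 :: "real \<Rightarrow> real"
  assumes "open I" and "is_interval I" and "I \<noteq> {}"
    and "frenet_curve I \<alpha> T N B1 B2 \<kappa>1 \<kappa>2 \<kappa>3"
    and "\<And>s. s \<in> I \<Longrightarrow> \<kappa>1 s \<noteq> 0 \<and> \<kappa>2 s \<noteq> 0 \<and> \<kappa>3 s \<noteq> 0"
  shows "(slant_helix I N \<longleftrightarrow>
            (\<exists>K. antiderivative_on I \<kappa>1 K \<and>
                 (\<exists>s\<in>I. second_binormal_term \<kappa>1 \<kappa>2 \<kappa>3 K s \<noteq> 0) \<and>
                 slant_function \<kappa>1 \<kappa>2 \<kappa>3 K constant_on I))
       \<and> (\<forall>U \<theta>. slant_axis I N U \<theta> \<longrightarrow>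
            (\<exists>K. antiderivative_on I \<kappa>1 K \<and>
                 (\<exists>s\<in>I. second_binormal_term \<kappa>1 \<kappa>2 \<kappa>3 K s \<noteq> 0) \<and>
                 (\<forall>s\<in>I. slant_function \<kappa>1 \<kappa>2 \<kappa>3 K s = (tan \<theta>)\<^sup>2)))
       \<and> (\<forall>K C. antiderivative_on I \<kappa>1 K \<and>
                 (\<exists>s\<in>I. second_binormal_term \<kappa>1 \<kappa>2 \<kappa>3 K s \<noteq> 0) \<and>
                 (\<forall>s\<in>I. slant_function \<kappa>1 \<kappa>2 \<kappa>3 K s = C) \<longrightarrow>
            (\<exists>U \<theta>. slant_axis I N U \<theta> \<and> C = (tan \<theta>)\<^sup>2))"
proof -
  have axis_imp: "\<exists>K. antiderivative_on I \<kappa>1 K \<and>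
      (\<exists>s\<in>I. second_binormal_term \<kappa>1 \<kappa>2 \<kappa>3 K s \<noteq> 0) \<and>
      (\<forall>s\<in>I. slant_function \<kappa>1 \<kappa>2 \<kappa>3 K s = (tan \<theta>)\<^sup>2)"
    if "slant_axis I N U \<theta>" for U \<theta>
    using slant_axis_imp_slant_function[OF assms(1,3,4,5) that] .
  have imp_axis: "\<exists>U \<theta>. slant_axis I N U \<theta> \<and> C = (tan \<theta>)\<^sup>2"
    if "antiderivative_on I \<kappa>1 K" "\<exists>s\<in>I. second_binormal_term \<kappa>1 \<kappa>2 \<kappa>3 K s \<noteq> 0"
      "\<forall>s\<in>I. slant_function \<kappa>1 \<kappa>2 \<kappa>3 K s = C" for K C
    by (rule slant_function_constant_imp_slant_axis[OF assms(1,2,4,5) that(1,2)]) (use that in auto)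
  have "slant_helix I N \<longleftrightarrow>
      (\<exists>K. antiderivative_on I \<kappa>1 K \<and>
           (\<exists>s\<in>I. second_binormal_term \<kappa>1 \<kappa>2 \<kappa>3 K s \<noteq> 0) \<and>
           slant_function \<kappa>1 \<kappa>2 \<kappa>3 K constant_on I)"
  proof
    assume "slant_helix I N"
    then show "\<exists>K. antiderivative_on I \<kappa>1 K \<and>
           (\<exists>s\<in>I. second_binormal_term \<kappa>1 \<kappa>2 \<kappa>3 K s \<noteq> 0) \<and>
           slant_function \<kappa>1 \<kappa>2 \<kappa>3 K constant_on I"
      unfolding slant_helix_def constant_on_def using axis_imp by meson
  next
    assume "\<exists>K. antiderivative_on I \<kappa>1 K \<and>
           (\<exists>s\<in>I. second_binormal_term \<kappa>1 \<kappa>2 \<kappa>3 K s \<noteq> 0) \<and>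
           slant_function \<kappa>1 \<kappa>2 \<kappa>3 K constant_on I"
    then show "slant_helix I N"
      unfolding slant_helix_def constant_on_def using imp_axis by meson
  qed
  then show ?thesis
    using axis_imp imp_axis by blast
qed

end
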